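(* There exist two matchings $M_1=(V,E_1)$ and $M_2=(V,E_2)$ on the same vertex set $V$ and a quasiplanar drawing $\Gamma_1$ of $M_1$ such that $\langle M_1,M_2\rangle$ does not admit a QuaSEFE in which the drawing of $M_1$ is $\Gamma_1$.
   Context: A matching on $V$ is a graph with vertex set $V$ whose edges are pairwise vertex-disjoint. Drawings are topological: vertices are distinct points of the plane and edges are curves joining their endpoints. A drawing is quasiplanar if no three of its edges pairwise cross. Given graphs $G_1=(V,E_1),\ldots,G_k=(V,E_k)$ on a shared vertex set $V$, the tuple $\langle G_1,\ldots,G_k\rangle$ admits a QuaSEFE if there are quasiplanar drawings $\Gamma_1,\ldots,\Gamma_k$ of $G_1,\ldots,G_k$ such that each vertex of $V$ has the same position in every $\Gamma_i$ and each edge shared by $G_i$ and $G_j$ is drawn as the same curve in $\Gamma_i$ and $\Gamma_j$. *)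

theory Defs
  imports "HOL-Analysis.Analysis"
begin

definition simple_graph :: "'v set \<Rightarrow> 'v set set \<Rightarrow> bool" where
  "simple_graph V E \<longleftrightarrow> finite V \<and> (\<forall>e\<in>E. e \<subseteq> V \<and> card e = 2)"

definition matching :: "'v set \<Rightarrow> 'v set set \<Rightarrow> bool" where
  "matching V E \<longleftrightarrow> simple_graph V E \<and> (\<forall>e\<in>E. \<forall>f\<in>E. e \<noteq> f \<longrightarrow> e \<inter> f = {})"

text \<open>Two plane curves, given as point sets, cross at \<open>x\<close> if some neighbourhood of \<open>x\<close> can be
  mapped homeomorphically to the open unit disc so that the curves become the horizontal and the
  vertical diameter. Touching points and endpoints of either curve are therefore not crossings.\<close>

definition crossing_point :: "complex set \<Rightarrow> complex set \<Rightarrow> complex \<Rightarrow> bool" where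
  "crossing_point C D x \<longleftrightarrow>
     (\<exists>U h k. open U \<and> x \<in> U \<and> homeomorphism U (ball 0 1) h k \<and> h x = 0 \<and>
        h ` (C \<inter> U) = {z \<in> ball 0 1. Im z = 0} \<and>
        h ` (D \<inter> U) = {z \<in> ball 0 1. Re z = 0})"

definition cross :: "complex set \<Rightarrow> complex set \<Rightarrow> bool" where
  "cross C D \<longleftrightarrow> (\<exists>x. crossing_point C D x)"

text \<open>The curve of an edge is a point set, so that drawing an edge as the same curve does not
  depend on a parametrization. The values of \<open>pos\<close> outside the vertex set and of \<open>curve\<close> outside
  the edge set are irrelevant.\<close>

record 'v drawing =
  pos :: "'v \<Rightarrow> complex"
  curve :: "'v set \<Rightarrow> complex set"

text \<open>The usual conventions for topological drawings: edges are Jordan arcs that contain no vertex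
  except their endpoints, and any two of them have finitely many points in common, each being a
  common endpoint or a crossing. Three or more edges may pass through the same crossing point.\<close>

definition drawing_of :: "'v set \<Rightarrow> 'v set set \<Rightarrow> 'v drawing \<Rightarrow> bool" where
  "drawing_of V E \<Gamma> \<longleftrightarrow>
     inj_on (pos \<Gamma>) V \<and>
     (\<forall>e\<in>E. \<exists>g. arc g \<and> path_image g = curve \<Gamma> e \<and> {pathstart g, pathfinish g} = pos \<Gamma> ` e) \<and>
     (\<forall>e\<in>E. \<forall>v\<in>V. v \<notin> e \<longrightarrow> pos \<Gamma> v \<notin> curve \<Gamma> e) \<and>
     (\<forall>e\<in>E. \<forall>f\<in>E. e \<noteq> f \<longrightarrow>
        finite (curve \<Gamma> e \<inter> curve \<Gamma> f) \<and>
        (\<forall>x \<in> curve \<Gamma> e \<inter> curve \<Gamma> f.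
           x \<in> pos \<Gamma> ` (e \<inter> f) \<or> crossing_point (curve \<Gamma> e) (curve \<Gamma> f) x))"

definition quasiplanar_drawing :: "'v set \<Rightarrow> 'v set set \<Rightarrow> 'v drawing \<Rightarrow> bool" where
  "quasiplanar_drawing V E \<Gamma> \<longleftrightarrow>
     drawing_of V E \<Gamma> \<and>
     \<not> (\<exists>e\<in>E. \<exists>f\<in>E. \<exists>g\<in>E. e \<noteq> f \<and> e \<noteq> g \<and> f \<noteq> g \<and>
          cross (curve \<Gamma> e) (curve \<Gamma> f) \<and>
          cross (curve \<Gamma> e) (curve \<Gamma> g) \<and>
          cross (curve \<Gamma> f) (curve \<Gamma> g))"

text \<open>A tuple of graphs on a shared vertex set is given by the list of their edge sets.\<close>

definition quasefe :: "'v set \<Rightarrow> 'v set set list \<Rightarrow> 'v drawing list \<Rightarrow> bool" where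
  "quasefe V Es \<Gamma>s \<longleftrightarrow>
     length \<Gamma>s = length Es \<and>
     (\<forall>i<length Es. quasiplanar_drawing V (Es ! i) (\<Gamma>s ! i)) \<and>
     (\<forall>i<length Es. \<forall>j<length Es.
        (\<forall>v\<in>V. pos (\<Gamma>s ! i) v = pos (\<Gamma>s ! j) v) \<and>
        (\<forall>e \<in> Es ! i \<inter> Es ! j. curve (\<Gamma>s ! i) e = curve (\<Gamma>s ! j) e))"

definition same_drawing :: "'v set \<Rightarrow> 'v set set \<Rightarrow> 'v drawing \<Rightarrow> 'v drawing \<Rightarrow> bool" where
  "same_drawing V E \<Gamma> \<Delta> \<longleftrightarrow>
     (\<forall>v\<in>V. pos \<Gamma> v = pos \<Delta> v) \<and> (\<forall>e\<in>E. curve \<Gamma> e = curve \<Delta> e)"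

end

theory Submission
  imports Defs
begin

text \<open>
  Five arcs surround a point \<open>u\<close>. Cyclically consecutive arcs cross, and their union contains a
  closed curve that separates \<open>u\<close> from a point \<open>v\<close> outside; all other pairs are disjoint, so no three
  arcs pairwise cross. The first matching consists of these arcs, the second one has the
  additional edge \<open>uv\<close>. Hence the drawing of the first matching prescribes all edges of the
  second one but \<open>uv\<close>. That edge crosses one of any two consecutive arcs. As five is odd, it
  crosses both arcs of some consecutive pair, which gives three pairwise crossing edges.

  The arcs and closed curves are explicit rectilinear polygons with integer vertices, so their
  incidences are decided by comparing coordinates. A closed polygon separates \<open>u\<close> from \<open>v\<close> because
  the vertical segment \<open>uv\<close> meets it in a single point, in the interior of a horizontal edge.
\<close>

subsection \<open>Rectilinear polygons with integer vertices\<close>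

type_synonym lpoint = "int \<times> int"

section \<open>Lattice points, axis-parallel segments and the paths that they form\<close>

definition pt :: "lpoint \<Rightarrow> complex" where
  "pt p = Complex (of_int (fst p)) (of_int (snd p))"

definition segs :: "lpoint list \<Rightarrow> (lpoint \<times> lpoint) list" where
  "segs ps = zip ps (tl ps)"

definition seg :: "lpoint \<times> lpoint \<Rightarrow> complex set" where
  "seg s = closed_segment (pt (fst s)) (pt (snd s))"

definition pset :: "lpoint list \<Rightarrow> complex set" where
  "pset ps = (\<Union>s\<in>set (segs ps). seg s)"

text \<open>The join is nested to the right, so that induction removes the first segment, as in
  \<open>rect_arc\<close>. Lists with fewer than two points get a dummy constant path at
  \<open>0\<close>; \<open>rect_arc\<close> rejects them.\<close>

fun ppath :: "lpoint list \<Rightarrow> real \<Rightarrow> complex" where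
  "ppath (p # q # r # ps) = linepath (pt p) (pt q) +++ ppath (q # r # ps)"
| "ppath [p, q] = linepath (pt p) (pt q)"
| "ppath _ = linepath 0 0"

text \<open>Strict separation of the bounding boxes along one axis, a decidable condition on
  integers. An axis-parallel segment is its own bounding box, so nothing is lost for such segments.
  A pair of equal points serves as a single point.\<close>

definition apart :: "lpoint \<times> lpoint \<Rightarrow> lpoint \<times> lpoint \<Rightarrow> bool" where
  "apart s t \<longleftrightarrow>
     max (fst (fst s)) (fst (snd s)) < min (fst (fst t)) (fst (snd t)) \<or>
     max (fst (fst t)) (fst (snd t)) < min (fst (fst s)) (fst (snd s)) \<or>
     max (snd (fst s)) (snd (snd s)) < min (snd (fst t)) (snd (snd t)) \<or>
     max (snd (fst t)) (snd (snd t)) < min (snd (fst s)) (snd (snd s))"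

definition hor_between :: "lpoint \<times> lpoint \<Rightarrow> int \<Rightarrow> bool" where
  "hor_between s a \<longleftrightarrow> snd (fst s) = snd (snd s) \<and>
     min (fst (fst s)) (fst (snd s)) < a \<and> a < max (fst (fst s)) (fst (snd s))"

definition ver_between :: "lpoint \<times> lpoint \<Rightarrow> int \<Rightarrow> bool" where
  "ver_between s b \<longleftrightarrow> fst (fst s) = fst (snd s) \<and>
     min (snd (fst s)) (snd (snd s)) < b \<and> b < max (snd (fst s)) (snd (snd s))"

definition plus_cross :: "lpoint \<times> lpoint \<Rightarrow> lpoint \<times> lpoint \<Rightarrow> bool" where
  "plus_cross s t \<longleftrightarrow> hor_between s (fst (fst t)) \<and> ver_between t (snd (fst s))"

definition bend :: "lpoint \<Rightarrow> lpoint \<Rightarrow> lpoint \<Rightarrow> bool" where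
  "bend p q r \<longleftrightarrow> fst p = fst q \<and> snd q = snd r \<or> snd p = snd q \<and> fst q = fst r"

text \<open>Consecutive segments turn at a right angle and so share only the bend; all other pairs
  are \<open>apart\<close>. This excludes self-intersections.\<close>

fun rect_arc :: "lpoint list \<Rightarrow> bool" where
  "rect_arc (p # q # r # ps) \<longleftrightarrow>
     p \<noteq> q \<and> bend p q r \<and> list_all (apart (p, q)) (segs (r # ps)) \<and> rect_arc (q # r # ps)"
| "rect_arc [p, q] \<longleftrightarrow> p \<noteq> q"
| "rect_arc _ \<longleftrightarrow> False"

lemma pt_simps [simp]: "Re (pt p) = of_int (fst p)" "Im (pt p) = of_int (snd p)"
  by (simp_all add: pt_def)

lemma pt_eq_iff [simp]: "pt p = pt q \<longleftrightarrow> p = q"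
  by (auto simp: pt_def prod_eq_iff)

lemma segs_Cons2: "segs (p # q # ps) = (p, q) # segs (q # ps)"
  by (simp add: segs_def)

lemma segs_short [simp]: "segs [] = []" "segs [p] = []"
  by (simp_all add: segs_def)

lemma pset_Cons2: "pset (p # q # ps) = seg (p, q) \<union> pset (q # ps)"
  by (auto simp: pset_def segs_Cons2)

lemma pset_single [simp]: "pset [p] = {}"
  by (simp add: pset_def)

lemma closed_pset: "closed (pset ps)"
  by (auto simp: pset_def seg_def intro!: closed_UN)

text \<open>Real and imaginary part are linear, so they map the segment onto a real interval between
  the coordinates of its ends.\<close>

lemma closed_segment_Re_Im_bounds:
  assumes "z \<in> closed_segment a b"
  shows "min (Re a) (Re b) \<le> Re z" "Re z \<le> max (Re a) (Re b)"
    "min (Im a) (Im b) \<le> Im z" "Im z \<le> max (Im a) (Im b)"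
proof -
  have "Re z \<in> closed_segment (Re a) (Re b)"
    using assms closed_segment_linear_image[of Re a b] bounded_linear.linear[OF bounded_linear_Re]
    by blast
  moreover have "Im z \<in> closed_segment (Im a) (Im b)"
    using assms closed_segment_linear_image[of Im a b] bounded_linear.linear[OF bounded_linear_Im]
    by blast
  ultimately show "min (Re a) (Re b) \<le> Re z" "Re z \<le> max (Re a) (Re b)"
    "min (Im a) (Im b) \<le> Im z" "Im z \<le> max (Im a) (Im b)"
    by (auto simp: closed_segment_eq_real_ivl split: if_splits)
qed

lemma seg_bounds:
  assumes "z \<in> seg s"
  shows "of_int (min (fst (fst s)) (fst (snd s))) \<le> Re z"
    "Re z \<le> of_int (max (fst (fst s)) (fst (snd s)))"
    "of_int (min (snd (fst s)) (snd (snd s))) \<le> Im z"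
    "Im z \<le> of_int (max (snd (fst s)) (snd (snd s)))"
  using closed_segment_Re_Im_bounds[of z "pt (fst s)" "pt (snd s)"] assms
  by (simp_all add: seg_def of_int_min of_int_max)

lemma apart_disjoint:
  assumes "apart s t"
  shows "seg s \<inter> seg t = {}"
proof (rule ccontr)
  assume "seg s \<inter> seg t \<noteq> {}"
  then obtain z where "z \<in> seg s" "z \<in> seg t"
    by blast
  note b = seg_bounds[OF this(1)] seg_bounds[OF this(2)]
  have "(of_int i :: real) < of_int j" if "i < j" for i j :: int
    using that by simp
  with assms b show False
    unfolding apart_def by (smt (verit))
qed

lemma apart_pset_disjoint:
  assumes "list_all (apart s) (segs ps)"
  shows "seg s \<inter> pset ps = {}"
  using assms apart_disjoint by (fastforce simp: pset_def list_all_iff)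

lemma bend_Int:
  assumes "bend p q r"
  shows "seg (p, q) \<inter> seg (q, r) \<subseteq> {pt q}"
proof
  fix z
  assume "z \<in> seg (p, q) \<inter> seg (q, r)"
  then have "z \<in> seg (p, q)" "z \<in> seg (q, r)"
    by auto
  note b = seg_bounds[OF this(1)] seg_bounds[OF this(2)]
  from assms b have "Re z = of_int (fst q) \<and> Im z = of_int (snd q)"
    unfolding bend_def by fastforce
  then show "z \<in> {pt q}"
    by (simp add: complex_eq_iff)
qed

lemma rect_arc_first_Int:
  assumes "rect_arc (p # q # ps)"
  shows "seg (p, q) \<inter> pset (q # ps) \<subseteq> {pt q}"
proof (cases ps)
  case (Cons r rs)
  with assms have "bend p q r" "list_all (apart (p, q)) (segs (r # rs))"
    by auto
  with bend_Int[of p q r] apart_pset_disjoint[of "(p, q)" "r # rs"] show ?thesis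
    by (auto simp: Cons pset_Cons2)
qed auto

text \<open>Each added segment touches the remaining arc only in their common end, so
  \<open>arc_join\<close> applies at every step.\<close>

lemma rect_arc_arc:
  assumes "rect_arc ps"
  shows "arc (ppath ps) \<and> path_image (ppath ps) = pset ps \<and>
    pathstart (ppath ps) = pt (hd ps) \<and> pathfinish (ppath ps) = pt (last ps)"
  using assms
proof (induction ps rule: ppath.induct)
  case (1 p q r ps)
  then have IH: "arc (ppath (q # r # ps))" "path_image (ppath (q # r # ps)) = pset (q # r # ps)"
    "pathstart (ppath (q # r # ps)) = pt q" "pathfinish (ppath (q # r # ps)) = pt (last (r # ps))"
    by auto
  have int: "seg (p, q) \<inter> pset (q # r # ps) \<subseteq> {pt q}"
    using rect_arc_first_Int 1(2) by blast
  have "arc (linepath (pt p) (pt q) +++ ppath (q # r # ps))"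
    using 1(2) IH int by (intro arc_join) (auto simp: seg_def)
  with IH show ?case
    by (auto simp: path_image_join pset_Cons2 seg_def)
qed (auto simp: pset_Cons2 seg_def)

lemma rect_arc_segs_Int:
  assumes "rect_arc ps" "s \<in> set (segs ps)" "t \<in> set (segs ps)" "s \<noteq> t"
  shows "seg s \<inter> seg t \<subseteq> {pt (fst s), pt (snd s)}"
  using assms
proof (induction ps rule: ppath.induct)
  case (1 p q r ps)
  have arc: "rect_arc (p # q # r # ps)" "rect_arc (q # r # ps)"
    using 1(2) by simp_all
  have first: "seg (p, q) \<inter> seg t' \<subseteq> {pt q}" if "t' \<in> set (segs (q # r # ps))" for t'
    using rect_arc_first_Int[OF arc(1)] that unfolding pset_def by blast
  have later: "t' = (q, r) \<or> seg (p, q) \<inter> seg t' = {}" if "t' \<in> set (segs (q # r # ps))" for t'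
  proof -
    have "t' = (q, r) \<or> t' \<in> set (segs (r # ps))"
      using that by (simp add: segs_Cons2)
    moreover have "seg (p, q) \<inter> pset (r # ps) = {}"
      using arc(1) by (intro apart_pset_disjoint) simp
    ultimately show ?thesis
      unfolding pset_def by blast
  qed
  consider "s = (p, q)" "t \<in> set (segs (q # r # ps))"
    | "t = (p, q)" "s \<in> set (segs (q # r # ps))"
    | "s \<in> set (segs (q # r # ps))" "t \<in> set (segs (q # r # ps))"
    using 1(3-5) unfolding segs_Cons2[of p] by auto
  then show ?case
  proof cases
    case 1
    then show ?thesis
      using first[of t] by auto
  next
    case 2
    show ?thesis
    \<comment> \<open>The common point \<open>pt q\<close> is an endpoint of \<open>s\<close> if
      \<open>s\<close> directly follows \<open>t\<close>; any later segment is disjoint from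
      \<open>t\<close> altogether.\<close>
    proof (cases "s = (q, r)")
      case True
      then show ?thesis
        using first[OF 2(2)] 2(1) by auto
    next
      case False
      then show ?thesis
        using later[OF 2(2)] 2(1) by blast
    qed
  next
    case 3
    then show ?thesis
      using 1(1)[OF arc(2)] 1(5) by blast
  qed
qed (simp_all add: segs_Cons2)

lemma hor_between_in_seg:
  assumes "hor_between s a" "Im z = of_int (snd (fst s))"
    "of_int (min (fst (fst s)) (fst (snd s))) \<le> Re z" "Re z \<le> of_int (max (fst (fst s)) (fst (snd s)))"
  shows "z \<in> seg s"
  using assms
  by (auto simp: hor_between_def seg_def closed_segment_same_Im closed_segment_eq_real_ivl)

lemma ver_between_in_seg:
  assumes "ver_between s b" "Re z = of_int (fst (fst s))"
    "of_int (min (snd (fst s)) (snd (snd s))) \<le> Im z" "Im z \<le> of_int (max (snd (fst s)) (snd (snd s)))"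
  shows "z \<in> seg s"
  using assms
  by (auto simp: ver_between_def seg_def closed_segment_same_Re closed_segment_eq_real_ivl)

subsection \<open>Crossings\<close>

lemma crossing_point_sym:
  assumes "crossing_point C D x"
  shows "crossing_point D C x"
proof -
  from assms obtain U h k where U: "open U" "x \<in> U" "homeomorphism U (ball 0 1) h k" "h x = 0"
    and C: "h ` (C \<inter> U) = {z \<in> ball 0 1. Im z = 0}"
    and D: "h ` (D \<inter> U) = {z \<in> ball 0 1. Re z = 0}"
    unfolding crossing_point_def by blast
  \<comment> \<open>Reflection in the diagonal: an involution of the disc that swaps its horizontal
    and vertical diameters.\<close>
  define \<sigma> where "\<sigma> z = \<i> * cnj z" for z
  have \<sigma>: "homeomorphism (ball 0 1) (ball 0 1) \<sigma> \<sigma>"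
    unfolding \<sigma>_def
    by (rule homeomorphismI) (auto intro!: continuous_intros simp: norm_mult)
  have inv: "\<sigma> (\<sigma> z) = z" for z
    by (simp add: \<sigma>_def)
  have img: "\<sigma> ` A = {w. \<sigma> w \<in> A}" for A
  proof (intro equalityI subsetI)
    fix w
    assume "w \<in> {w. \<sigma> w \<in> A}"
    then have "\<sigma> (\<sigma> w) \<in> \<sigma> ` A"
      by blast
    then show "w \<in> \<sigma> ` A"
      by (simp add: inv)
  qed (auto simp: inv)
  have im: "\<sigma> ` {z \<in> ball 0 1. Re z = 0} = {z \<in> ball 0 1. Im z = 0}"
    "\<sigma> ` {z \<in> ball 0 1. Im z = 0} = {z \<in> ball 0 1. Re z = 0}"
    unfolding img by (auto simp: \<sigma>_def norm_mult)
  have "homeomorphism U (ball 0 1) (\<sigma> \<circ> h) (k \<circ> \<sigma>)"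
    using homeomorphism_compose[OF U(3) \<sigma>] by simp
  moreover have "(\<sigma> \<circ> h) ` (D \<inter> U) = {z \<in> ball 0 1. Im z = 0}"
    "(\<sigma> \<circ> h) ` (C \<inter> U) = {z \<in> ball 0 1. Re z = 0}"
    by (simp_all only: image_comp[symmetric] C D im)
  moreover have "(\<sigma> \<circ> h) x = 0"
    using U by (simp add: \<sigma>_def)
  ultimately show ?thesis
    unfolding crossing_point_def using U(1,2) by blast
qed

text \<open>Moving \<open>x\<close> to the origin and scaling by \<open>1 / r\<close> maps the ball
  to the unit disc and preserves horizontal and vertical lines.\<close>

lemma crossing_pointI:
  assumes "r > 0"
    and C: "C \<inter> ball x r = {z \<in> ball x r. Im z = Im x}"
    and D: "D \<inter> ball x r = {z \<in> ball x r. Re z = Re x}"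
  shows "crossing_point C D x"
proof -
  define h where "h z = (z - x) / of_real r" for z
  define k where "k w = x + of_real r * w" for w
  have kh: "k (h z) = z" and hk: "h (k z) = z" for z
    using \<open>r > 0\<close> by (simp_all add: h_def k_def)
  have hb: "h z \<in> ball 0 1 \<longleftrightarrow> z \<in> ball x r" for z
    using \<open>r > 0\<close> by (simp add: h_def norm_divide dist_norm norm_minus_commute)
  have kb: "k z \<in> ball x r \<longleftrightarrow> z \<in> ball 0 1" for z
    using hb[of "k z"] by (simp add: hk)
  have "homeomorphism (ball x r) (ball 0 1) h k"
    by (rule homeomorphismI)
      (use hb kb kh hk \<open>r > 0\<close> in \<open>auto intro!: continuous_intros simp: h_def k_def\<close>)
  moreover have "h ` {z \<in> ball x r. Im z = Im x} = {z \<in> ball 0 1. Im z = 0}"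
  proof (intro equalityI subsetI)
    fix w assume "w \<in> {z \<in> ball 0 1. Im z = 0}"
    then have "k w \<in> {z \<in> ball x r. Im z = Im x}"
      using kb by (simp add: k_def del: mem_ball)
    then show "w \<in> h ` {z \<in> ball x r. Im z = Im x}"
      by (metis hk imageI)
  qed (use hb in \<open>auto simp: h_def\<close>)
  moreover have "h ` {z \<in> ball x r. Re z = Re x} = {z \<in> ball 0 1. Re z = 0}"
  proof (intro equalityI subsetI)
    fix w assume "w \<in> {z \<in> ball 0 1. Re z = 0}"
    then have "k w \<in> {z \<in> ball x r. Re z = Re x}"
      using kb by (simp add: k_def del: mem_ball)
    then show "w \<in> h ` {z \<in> ball x r. Re z = Re x}"
      by (metis hk imageI)
  qed (use hb in \<open>auto simp: h_def\<close>)
  ultimately show ?thesis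
    unfolding crossing_point_def
    using \<open>r > 0\<close> C D by (intro exI[of _ "ball x r"] exI[of _ h] exI[of _ k]) (simp add: h_def)
qed

text \<open>All coordinates are integers, so a point strictly between the ends has distance at least
  1 from both. A ball of radius at most 1 around it therefore cannot reach past them.\<close>

lemma hor_seg_local:
  assumes "hor_between s (fst a)" "snd a = snd (fst s)" "r \<le> 1"
  shows "seg s \<inter> ball (pt a) r = {z \<in> ball (pt a) r. Im z = Im (pt a)}"
proof -
  have "Im z = of_int (snd a)" if "z \<in> seg s" for z
    using seg_bounds(3,4)[OF that] assms(1,2) by (simp add: hor_between_def)
  moreover have "z \<in> seg s" if "z \<in> ball (pt a) r" "Im z = of_int (snd a)" for z
  proof (rule hor_between_in_seg[OF assms(1)])
    have "dist (pt a) z < 1"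
      using that(1) assms(3) by simp
    then have "\<bar>Re z - of_int (fst a)\<bar> < 1"
      using abs_Re_le_cmod[of "pt a - z"] by (simp add: dist_norm)
    then show "real_of_int (min (fst (fst s)) (fst (snd s))) \<le> Re z"
      "Re z \<le> real_of_int (max (fst (fst s)) (fst (snd s)))"
      using assms(1) unfolding hor_between_def by linarith+
  qed (use assms(2) that(2) in simp)
  ultimately show ?thesis
    unfolding pt_simps by blast
qed

lemma ver_seg_local:
  assumes "ver_between s (snd a)" "fst a = fst (fst s)" "r \<le> 1"
  shows "seg s \<inter> ball (pt a) r = {z \<in> ball (pt a) r. Re z = Re (pt a)}"
proof -
  have "Re z = of_int (fst a)" if "z \<in> seg s" for z
    using seg_bounds(1,2)[OF that] assms(1,2) by (simp add: ver_between_def)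
  moreover have "z \<in> seg s" if "z \<in> ball (pt a) r" "Re z = of_int (fst a)" for z
  proof (rule ver_between_in_seg[OF assms(1)])
    have "dist (pt a) z < 1"
      using that(1) assms(3) by simp
    then have "\<bar>Im z - of_int (snd a)\<bar> < 1"
      using abs_Im_le_cmod[of "pt a - z"] by (simp add: dist_norm)
    then show "real_of_int (min (snd (fst s)) (snd (snd s))) \<le> Im z"
      "Im z \<le> real_of_int (max (snd (fst s)) (snd (snd s)))"
      using assms(1) unfolding ver_between_def by linarith+
  qed (use assms(2) that(2) in simp)
  ultimately show ?thesis
    unfolding pt_simps by blast
qed

text \<open>The other segments form a closed set that misses \<open>pt a\<close>. All smaller radii
  are included so that the radii for two arcs can be shrunk to a common one.\<close>

lemma rect_arc_local:
  assumes "rect_arc ps" "s \<in> set (segs ps)" "pt a \<in> seg s" "a \<noteq> fst s" "a \<noteq> snd s"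
  obtains r where "r > 0" "\<And>r'. r' \<le> r \<Longrightarrow> pset ps \<inter> ball (pt a) r' = seg s \<inter> ball (pt a) r'"
proof -
  define rest where "rest = (\<Union>t\<in>set (segs ps) - {s}. seg t)"
  have "closed rest"
    by (auto simp: rest_def seg_def)
  moreover have "pt a \<notin> rest"
  proof
    assume "pt a \<in> rest"
    then obtain t where "t \<in> set (segs ps)" "s \<noteq> t" "pt a \<in> seg t"
      unfolding rest_def by blast
    with rect_arc_segs_Int[OF assms(1,2)] assms(3) have "pt a \<in> {pt (fst s), pt (snd s)}"
      by blast
    with assms(4,5) show False
      by simp
  qed
  ultimately obtain r where "r > 0" "ball (pt a) r \<subseteq> - rest"
    using open_contains_ball[of "- rest"] by (auto simp: open_Compl)
  moreover have "pset ps = seg s \<union> rest"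
    using assms(2) by (auto simp: pset_def rest_def)
  ultimately have "pset ps \<inter> ball (pt a) r' = seg s \<inter> ball (pt a) r'" if "r' \<le> r" for r'
    using subset_ball[OF that, of "pt a"] by blast
  then show ?thesis
    using that[OF \<open>r > 0\<close>] by blast
qed

lemma plus_cross_point:
  assumes "plus_cross s t"
  defines "a \<equiv> (fst (fst t), snd (fst s))"
  shows "seg s \<inter> seg t = {pt a}"
    and "a \<notin> {fst s, snd s}" "a \<notin> {fst t, snd t}"
proof -
  have st: "hor_between s (fst a)" "ver_between t (snd a)" "snd a = snd (fst s)" "fst a = fst (fst t)"
    using assms(1) by (simp_all add: plus_cross_def a_def)
  have "z = pt a" if "z \<in> seg s" "z \<in> seg t" for z
    using st seg_bounds(3,4)[OF that(1)] seg_bounds(1,2)[OF that(2)]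
    by (simp add: hor_between_def ver_between_def complex_eq_iff)
  moreover have "pt a \<in> seg s"
    by (rule hor_between_in_seg[OF st(1)]) (use st(1,3) in \<open>simp_all add: hor_between_def\<close>)
  moreover have "pt a \<in> seg t"
    by (rule ver_between_in_seg[OF st(2)]) (use st(2,4) in \<open>simp_all add: ver_between_def\<close>)
  ultimately show "seg s \<inter> seg t = {pt a}"
    by blast
  show "a \<notin> {fst s, snd s}" "a \<notin> {fst t, snd t}"
    using st by (auto simp: hor_between_def ver_between_def)
qed

lemma plus_cross_crossing_point:
  assumes "rect_arc ps" "rect_arc qs" "s \<in> set (segs ps)" "t \<in> set (segs qs)" "plus_cross s t"
  shows "crossing_point (pset ps) (pset qs) (pt (fst (fst t), snd (fst s)))"
proof -
  define a where "a = (fst (fst t), snd (fst s))"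
  note a = plus_cross_point[OF assms(5), folded a_def]
  from a obtain r1 where r1: "r1 > 0"
      "\<And>r'. r' \<le> r1 \<Longrightarrow> pset ps \<inter> ball (pt a) r' = seg s \<inter> ball (pt a) r'"
    using rect_arc_local[OF assms(1,3), of a] by auto
  from a obtain r2 where r2: "r2 > 0"
      "\<And>r'. r' \<le> r2 \<Longrightarrow> pset qs \<inter> ball (pt a) r' = seg t \<inter> ball (pt a) r'"
    using rect_arc_local[OF assms(2,4), of a] by auto
  \<comment> \<open>Radius at most 1 makes both segments diameters of the ball; \<open>r1\<close>
    and \<open>r2\<close> make each arc agree with its segment there.\<close>
  define r where "r = min 1 (min r1 r2)"
  have "r > 0" "r \<le> 1" "r \<le> r1" "r \<le> r2"
    using r1 r2 by (auto simp: r_def)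
  with assms(5) r1(2) r2(2) have "crossing_point (pset ps) (pset qs) (pt a)"
    by (intro crossing_pointI[of r])
      (simp_all add: hor_seg_local ver_seg_local plus_cross_def a_def)
  then show ?thesis
    by (simp add: a_def)
qed

section \<open>Decidable conditions on pairs of arcs\<close>

definition seg_compat :: "lpoint \<times> lpoint \<Rightarrow> lpoint \<times> lpoint \<Rightarrow> bool" where
  "seg_compat s t \<longleftrightarrow> apart s t \<or> plus_cross s t \<or> plus_cross t s"

definition arcs_compat :: "lpoint list \<Rightarrow> lpoint list \<Rightarrow> bool" where
  "arcs_compat ps qs \<longleftrightarrow> list_all (\<lambda>s. list_all (seg_compat s) (segs qs)) (segs ps)"

text \<open>Common points arise only from perpendicular crossings of two segments, one point for
  each such pair.\<close>

lemma arcs_compat_crossing: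
  assumes "rect_arc ps" "rect_arc qs" "arcs_compat ps qs"
  shows "finite (pset ps \<inter> pset qs)"
    and "\<And>x. x \<in> pset ps \<inter> pset qs \<Longrightarrow> crossing_point (pset ps) (pset qs) x"
proof -
  have compat: "seg s \<inter> seg t = {} \<or> plus_cross s t \<or> plus_cross t s"
    if "s \<in> set (segs ps)" "t \<in> set (segs qs)" for s t
    using assms(3) that apart_disjoint[of s t]
    by (auto simp: arcs_compat_def seg_compat_def list_all_iff)
  have "finite (seg s \<inter> seg t)" if "s \<in> set (segs ps)" "t \<in> set (segs qs)" for s t
    using compat[OF that] plus_cross_point(1)[of s t] plus_cross_point(1)[of t s]
    by (auto simp: Int_commute)
  moreover have "pset ps \<inter> pset qs = (\<Union>s\<in>set (segs ps). \<Union>t\<in>set (segs qs). seg s \<inter> seg t)"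
    by (auto simp: pset_def)
  ultimately show "finite (pset ps \<inter> pset qs)"
    by (metis (no_types, lifting) List.finite_set finite_UN_I)
  fix x
  assume "x \<in> pset ps \<inter> pset qs"
  then obtain s t where st: "s \<in> set (segs ps)" "t \<in> set (segs qs)" "x \<in> seg s" "x \<in> seg t"
    by (auto simp: pset_def)
  with compat[OF st(1,2)] consider "plus_cross s t" | "plus_cross t s"
    by blast
  then show "crossing_point (pset ps) (pset qs) x"
  proof cases
    case 1
    with st plus_cross_point(1)[of s t] have "x = pt (fst (fst t), snd (fst s))"
      by blast
    with 1 show ?thesis
      using plus_cross_crossing_point[OF assms(1,2) st(1,2)] by simp
  next
    case 2
    with st plus_cross_point(1)[of t s] have "x = pt (fst (fst s), snd (fst t))"
      by blast
    with 2 show ?thesis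
      using plus_cross_crossing_point[OF assms(2,1) st(2,1)] by (simp add: crossing_point_sym)
  qed
qed

text \<open>The origin lies on both diameters and \<open>h\<close> is injective. This is what lets
  disjointness exclude a crossing.\<close>

lemma crossing_point_mem:
  assumes "crossing_point C D x"
  shows "x \<in> C \<inter> D"
proof -
  from assms obtain U h k where U: "x \<in> U" "homeomorphism U (ball 0 1) h k" "h x = 0"
    and C: "h ` (C \<inter> U) = {z \<in> ball 0 1. Im z = 0}"
    and D: "h ` (D \<inter> U) = {z \<in> ball 0 1. Re z = 0}"
    unfolding crossing_point_def by blast
  have "inj_on h U"
    using U(2) by (metis homeomorphism_apply1 inj_on_def)
  moreover have "0 \<in> h ` (C \<inter> U)" "0 \<in> h ` (D \<inter> U)"
    unfolding C D by simp_all
  ultimately show ?thesis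
    using U(1,3) by (metis (no_types, lifting) IntE IntI imageE inj_onD)
qed

definition arcs_apart :: "lpoint list \<Rightarrow> lpoint list \<Rightarrow> bool" where
  "arcs_apart ps qs \<longleftrightarrow> list_all (\<lambda>s. list_all (apart s) (segs qs)) (segs ps)"

definition arcs_meet :: "lpoint list \<Rightarrow> lpoint list \<Rightarrow> bool" where
  "arcs_meet ps qs \<longleftrightarrow>
     list_ex (\<lambda>s. list_ex (\<lambda>t. plus_cross s t \<or> plus_cross t s) (segs qs)) (segs ps)"

lemma arcs_apart_disjoint:
  assumes "arcs_apart ps qs"
  shows "pset ps \<inter> pset qs = {}"
proof -
  have "seg s \<inter> pset qs = {}" if "s \<in> set (segs ps)" for s
    using that assms by (auto simp: arcs_apart_def list_all_iff intro!: apart_pset_disjoint)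
  then show ?thesis
    unfolding pset_def[of ps] by blast
qed

lemma arcs_meet_Int:
  assumes "arcs_meet ps qs"
  shows "pset ps \<inter> pset qs \<noteq> {}"
proof -
  from assms obtain s t where st: "s \<in> set (segs ps)" "t \<in> set (segs qs)"
    "plus_cross s t \<or> plus_cross t s"
    by (auto simp: arcs_meet_def list_ex_iff)
  then have "seg s \<inter> seg t \<noteq> {}"
    using plus_cross_point(1)[of s t] plus_cross_point(1)[of t s] by blast
  then show ?thesis
    using st by (auto simp: pset_def)
qed

definition on_seg :: "lpoint \<times> lpoint \<Rightarrow> lpoint \<Rightarrow> bool" where
  "on_seg s p \<longleftrightarrow>
     snd (fst s) = snd (snd s) \<and> snd p = snd (fst s) \<and>
       min (fst (fst s)) (fst (snd s)) \<le> fst p \<and> fst p \<le> max (fst (fst s)) (fst (snd s)) \<or>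
     fst (fst s) = fst (snd s) \<and> fst p = fst (fst s) \<and>
       min (snd (fst s)) (snd (snd s)) \<le> snd p \<and> snd p \<le> max (snd (fst s)) (snd (snd s))"

lemma on_seg:
  assumes "on_seg s p"
  shows "pt p \<in> seg s"
  using assms
  by (auto simp: on_seg_def seg_def closed_segment_same_Im closed_segment_same_Re
      closed_segment_eq_real_ivl)

text \<open>The pair \<open>(last ps, hd ps)\<close> closes the polygon. By convexity it is enough
  to test the two ends of a side, provided that one segment contains both.\<close>

definition covered :: "lpoint list \<Rightarrow> lpoint list \<Rightarrow> lpoint list \<Rightarrow> bool" where
  "covered ps qs rs \<longleftrightarrow>
     list_all (\<lambda>s. list_ex (\<lambda>t. on_seg t (fst s) \<and> on_seg t (snd s)) (segs qs @ segs rs))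
       ((last ps, hd ps) # segs ps)"

lemma covered_subset:
  assumes "covered ps qs rs"
  shows "pset ps \<union> seg (last ps, hd ps) \<subseteq> pset qs \<union> pset rs"
proof -
  have "seg s \<subseteq> pset qs \<union> pset rs" if "s \<in> set ((last ps, hd ps) # segs ps)" for s
  proof -
    from assms that obtain t where t: "t \<in> set (segs qs) \<union> set (segs rs)"
      "on_seg t (fst s)" "on_seg t (snd s)"
      unfolding covered_def list_all_iff list_ex_iff set_append by meson
    then have "seg s \<subseteq> seg t"
      using on_seg[of t "fst s"] on_seg[of t "snd s"]
      by (simp add: seg_def closed_segment_subset)
    then show ?thesis
      using t(1) by (auto simp: pset_def)
  qed
  then show ?thesis
    unfolding pset_def[of ps] by (simp add: UN_subset_iff)
qed

subsection \<open>Separation by a Jordan curve\<close>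

text \<open>By the Jordan curve theorem \<open>x\<close> is a boundary point of inside and outside,
  so both meet the disc. If \<open>S\<close> joined the upper half disc to the lower one, the union
  of the three would be a connected set off the curve that meets both sides.\<close>

lemma Jordan_sides:
  fixes c :: "real \<Rightarrow> complex"
  assumes c: "simple_path c" "pathfinish c = pathstart c" and "x \<in> path_image c"
    and loc: "path_image c \<inter> ball x r = {z \<in> ball x r. Im z = Im x}" and "r > 0"
    and S: "connected S" "S \<inter> path_image c = {}"
    and above: "z \<in> S" "z \<in> ball x r" "Im z > Im x"
    and below: "w \<in> S" "w \<in> ball x r" "Im w < Im x"
  shows False
proof -
  define H where "H = {z. Im z > Im x} \<inter> ball x r"
  define K where "K = {z. Im z < Im x} \<inter> ball x r"
  have "connected H" "connected K"
    unfolding H_def K_def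
    by (auto intro!: convex_connected convex_Int simp: convex_halfspace_Im_gt convex_halfspace_Im_lt)
  with S above below have conn: "connected (H \<union> (S \<union> K))"
    by (intro connected_Un) (auto simp: H_def K_def)
  have ball: "ball x r - path_image c = H \<union> K"
  proof -
    have "ball x r - path_image c = ball x r - (path_image c \<inter> ball x r)"
      by blast
    also have "\<dots> = H \<union> K"
      unfolding loc H_def K_def by (auto simp: neq_iff)
    finally show ?thesis .
  qed
  define I where "I = inside (path_image c)"
  define Out where "Out = outside (path_image c)"
  have J: "open I" "open Out" "I \<inter> Out = {}" "I \<union> Out = - path_image c"
    "frontier I = path_image c" "frontier Out = path_image c"
    using Jordan_inside_outside[OF c] by (simp_all add: I_def Out_def)
  have "x \<in> closure I" "x \<in> closure Out"
    using J(5,6) \<open>x \<in> path_image c\<close> by (auto simp: frontier_def)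
  then have "I \<inter> ball x r \<noteq> {}" "Out \<inter> ball x r \<noteq> {}"
    using open_Int_closure_eq_empty[OF open_ball[of x r]] centre_in_ball[of x r] \<open>r > 0\<close>
    by blast+
  then have "I \<inter> (H \<union> (S \<union> K)) \<noteq> {}" "Out \<inter> (H \<union> (S \<union> K)) \<noteq> {}"
    using ball J(4) by blast+
  moreover have "H \<union> (S \<union> K) \<subseteq> I \<union> Out"
    using J(4) S(2) ball by blast
  ultimately show False
    using connectedD[OF conn J(1,2)] J(3) by blast
qed

text \<open>The edge from the last vertex back to the first one closes the polygon; it is horizontal and
  not listed. Segments on a vertical line through one of its endpoints may touch it there.\<close>

definition rect_loop :: "lpoint list \<Rightarrow> bool" where
  "rect_loop ps \<longleftrightarrow> rect_arc ps \<and> snd (hd ps) = snd (last ps) \<and> hd ps \<noteq> last ps \<and>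
     list_all (\<lambda>s. apart s (last ps, hd ps) \<or>
       fst (fst s) = fst (snd s) \<and> fst (fst s) \<in> {fst (hd ps), fst (last ps)}) (segs ps)"

text \<open>The listed path can meet the closing edge only on the vertical lines through its two
  ends, and at the height of that edge these lines contain just the ends.\<close>

lemma rect_loop_simple_path:
  assumes "rect_loop ps"
  defines "c \<equiv> ppath ps +++ linepath (pt (last ps)) (pt (hd ps))"
  shows "simple_path c" "pathfinish c = pathstart c"
    "path_image c = pset ps \<union> seg (last ps, hd ps)"
proof -
  have "rect_arc ps"
    using assms(1) by (simp add: rect_loop_def)
  note A = rect_arc_arc[OF this]
  have "z \<in> {pt (hd ps), pt (last ps)}" if z: "z \<in> pset ps" "z \<in> seg (last ps, hd ps)" for z
  proof -
    from z(1) obtain s where s: "s \<in> set (segs ps)" "z \<in> seg s"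
      by (auto simp: pset_def)
    with assms(1) z(2) apart_disjoint[of s "(last ps, hd ps)"]
    have "fst (fst s) = fst (snd s)" "fst (fst s) \<in> {fst (hd ps), fst (last ps)}"
      by (auto simp: rect_loop_def list_all_iff)
    with seg_bounds(1,2)[OF s(2)] have "Re z = fst (hd ps) \<or> Re z = fst (last ps)"
      by auto
    moreover have "Im z = snd (hd ps)" "snd (hd ps) = snd (last ps)"
      using seg_bounds(3,4)[OF z(2)] assms(1) by (auto simp: rect_loop_def)
    ultimately show ?thesis
      by (auto simp: complex_eq_iff)
  qed
  then show "simple_path c"
    unfolding c_def using A assms(1)
    by (intro simple_path_join_loop) (auto simp: rect_loop_def seg_def)
  show "pathfinish c = pathstart c" "path_image c = pset ps \<union> seg (last ps, hd ps)"
    unfolding c_def using A by (simp_all add: path_image_join seg_def)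
qed

text \<open>Otherwise \<open>S\<close>, prolonged from \<open>u\<close> and from \<open>v\<close>
  along the vertical segment until just before the closing edge, would join the two sides of the
  curve.\<close>

lemma rect_loop_separates:
  assumes "rect_loop ps" "connected S" "pt u \<in> S" "pt v \<in> S"
    and uv: "fst u = fst v" "snd v < snd (hd ps)" "snd (hd ps) < snd u"
    and hor: "hor_between (last ps, hd ps) (fst u)"
    and ray: "list_all (apart (u, v)) (segs ps)"
  shows "S \<inter> (pset ps \<union> seg (last ps, hd ps)) \<noteq> {}"
proof
  assume disj: "S \<inter> (pset ps \<union> seg (last ps, hd ps)) = {}"
  define c where "c = ppath ps +++ linepath (pt (last ps)) (pt (hd ps))"
  note c = rect_loop_simple_path[OF assms(1), folded c_def]
  define a where "a = (fst u, snd (hd ps))"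
  have hd_last: "snd (hd ps) = snd (last ps)"
    using assms(1) by (simp add: rect_loop_def)
  have in_ray: "z \<in> seg (u, v)" if "Re z = fst u" "snd v \<le> Im z" "Im z \<le> snd u" for z
    using that uv
    by (auto simp: seg_def closed_segment_same_Re closed_segment_eq_real_ivl)
  have ray_disj: "seg (u, v) \<inter> pset ps = {}"
    by (rule apart_pset_disjoint[OF ray])
  have "pt a \<notin> pset ps"
    using ray_disj in_ray[of "pt a"] uv by (auto simp: a_def)
  then obtain r0 where r0: "r0 > 0" "ball (pt a) r0 \<subseteq> - pset ps"
    using open_contains_ball[of "- pset ps"] closed_pset[of ps] by (auto simp: open_Compl)
  define r where "r = min 1 r0"
  have r: "r > 0" "r \<le> 1" "ball (pt a) r \<subseteq> - pset ps"
    using r0 by (auto simp: r_def)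
  have "seg (last ps, hd ps) \<inter> ball (pt a) r = {z \<in> ball (pt a) r. Im z = Im (pt a)}"
    by (rule hor_seg_local) (use hor hd_last r in \<open>auto simp: a_def\<close>)
  with r(3) have loc: "path_image c \<inter> ball (pt a) r = {z \<in> ball (pt a) r. Im z = Im (pt a)}"
    unfolding c(3) by blast
  have "pt a \<in> path_image c"
    using loc r(1) by (metis (mono_tags, lifting) IntD1 centre_in_ball mem_Collect_eq)
  define z where "z = pt a + \<i> * of_real (r / 2)"
  define w where "w = pt a - \<i> * of_real (r / 2)"
  have zw: "z \<in> ball (pt a) r" "w \<in> ball (pt a) r" "Im z > Im (pt a)" "Im w < Im (pt a)"
    using r(1) by (auto simp: z_def w_def dist_norm norm_mult)
  define T where "T = S \<union> closed_segment (pt u) z \<union> closed_segment (pt v) w"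
  have "connected T"
    unfolding T_def using assms(2-4) by (intro connected_Un) auto
  \<comment> \<open>Integer heights leave a margin of 1, so \<open>z\<close> and \<open>w\<close>,
    at distance at most \<open>1/2\<close> from \<open>pt a\<close>, still lie between
    \<open>u\<close> and \<open>v\<close>.\<close>
  have le: "real_of_int (snd v) \<le> snd a - 1" "snd a + 1 \<le> real_of_int (snd u)"
    using uv unfolding a_def by (simp_all add: int_less_real_le le_diff_eq)
  have off: "q \<notin> path_image c" if "q \<in> closed_segment (pt u) z \<or> q \<in> closed_segment (pt v) w" for q
  proof -
    have "Re q = fst u" "snd v \<le> Im q" "Im q \<le> snd u" "Im q \<noteq> snd (hd ps)"
      using that closed_segment_Re_Im_bounds[of q "pt u" z] closed_segment_Re_Im_bounds[of q "pt v" w]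
        uv r(1,2) le by (auto simp: z_def w_def a_def min_def max_def split: if_splits)
    then show ?thesis
      using in_ray[of q] ray_disj hd_last seg_bounds(3,4)[of q "(last ps, hd ps)"]
      unfolding c(3) by auto
  qed
  show False
    by (rule Jordan_sides[OF c(1,2) \<open>pt a \<in> path_image c\<close> loc r(1) \<open>connected T\<close> _ _ zw(1,3) _ zw(2,4)])
      (use off disj c(3) in \<open>auto simp: T_def\<close>)
qed

subsection \<open>The arrangement\<close>

text \<open>The polygons at indices 0, 1, 2 and 4 are rings around \<open>(1, -1)\<close>, each with
  a gap; the one at index 3 is a short hook through the gaps of rings 2 and 4.\<close>

definition polys :: "lpoint list list" where
  "polys =
    [[(2, 4), (2, 7), (5, 7), (5, 0), (13, 0), (13, -2), (0, -2), (0, 0), (1, 0), (1, 3)],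
     [(4, 6), (15, 6), (15, -4), (-2, -4), (-2, 6), (3, 6)],
     [(11, 4), (11, 8), (16, 8), (16, -5), (-3, -5), (-3, 8), (10, 8), (10, 4)],
     [(6, 3), (6, 1), (9, 1), (9, 5), (12, 5)],
     [(8, 2), (14, 2), (14, -3), (-1, -3), (-1, 2), (7, 2)]]"

text \<open>Each loop follows one ring and bridges its gap along a neighbouring arc; the rings are
  1, 2, 2, 4 and 0 in this order. The lists run from the lower left to the lower right corner, so
  that the closing edge is the bottom side.\<close>

definition loops :: "lpoint list list" where
  "loops =
    [[(-2, -4), (-2, 6), (2, 6), (2, 7), (5, 7), (5, 6), (15, 6), (15, -4)],
     [(-3, -5), (-3, 8), (10, 8), (10, 6), (11, 6), (11, 8), (16, 8), (16, -5)],
     [(-3, -5), (-3, 8), (10, 8), (10, 5), (11, 5), (11, 8), (16, 8), (16, -5)],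
     [(-1, -3), (-1, 2), (6, 2), (6, 1), (9, 1), (9, 2), (14, 2), (14, -3)],
     [(0, -2), (0, 0), (1, 0), (1, 2), (5, 2), (5, 0), (13, 0), (13, -2)]]"

text \<open>Positions \<open>2 * i\<close> and \<open>2 * i + 1\<close> hold the ends of arc
  \<open>i\<close>. The last two points are the ends of the additional edge: one inside all loops,
  the other below them.\<close>

definition verts :: "lpoint list" where
  "verts = concat (map (\<lambda>ps. [hd ps, last ps]) polys) @ [(1, -1), (1, -6)]"

section \<open>Finite checks on the arrangement\<close>

abbreviation (input) nbr :: "nat \<Rightarrow> nat" where
  "nbr i \<equiv> (i + 1) mod 5"

text \<open>Turns claims about the five arcs into list tests that can be evaluated.\<close>

lemma all_less_5: "(\<forall>i<5. Q i) \<longleftrightarrow> list_all Q [0, 1, 2, 3, 4 :: nat]"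
  by (auto simp: numeral_eq_Suc less_Suc_eq)

text \<open>Neighbouring indices form a cycle of length five, which contains no triangle.\<close>

lemma nbr_triangle_free:
  "\<forall>i<5. \<forall>j<5. \<forall>k<5. i \<noteq> j \<and> i \<noteq> k \<and> j \<noteq> k \<longrightarrow>
     \<not> ((j = nbr i \<or> i = nbr j) \<and> (k = nbr i \<or> i = nbr k) \<and> (k = nbr j \<or> j = nbr k))"
  unfolding all_less_5 by code_simp

lemma polys_rect_arc: "\<forall>i<5. rect_arc (polys ! i)"
  unfolding all_less_5 by code_simp

lemma polys_compat: "\<forall>i<5. \<forall>j<5. i \<noteq> j \<longrightarrow> arcs_compat (polys ! i) (polys ! j)"
  unfolding all_less_5 by code_simp

lemma polys_apart:
  "\<forall>i<5. \<forall>j<5. i = j \<or> j = nbr i \<or> i = nbr j \<or> arcs_apart (polys ! i) (polys ! j)"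
  unfolding all_less_5 by code_simp

lemma polys_meet: "\<forall>i<5. arcs_meet (polys ! i) (polys ! nbr i)"
  unfolding all_less_5 by code_simp

text \<open>A vertex enters as a degenerate segment; \<open>v div 2 = i\<close> exempts the two ends
  of arc \<open>i\<close>.\<close>

lemma verts_apart:
  "\<forall>i<5. list_all (\<lambda>v. v div 2 = i \<or>
     list_all (apart (verts ! v, verts ! v)) (segs (polys ! i))) [0..<12]"
  unfolding all_less_5 by code_simp

lemma loops_rect_loop: "\<forall>i<5. rect_loop (loops ! i)"
  unfolding all_less_5 by code_simp

lemma loops_covered: "\<forall>i<5. covered (loops ! i) (polys ! i) (polys ! nbr i)"
  unfolding all_less_5 by code_simp

lemma loops_ray:
  "\<forall>i<5. snd (verts ! 11) < snd (hd (loops ! i)) \<and> snd (hd (loops ! i)) < snd (verts ! 10) \<and>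
     hor_between (last (loops ! i), hd (loops ! i)) (fst (verts ! 10)) \<and>
     list_all (apart (verts ! 10, verts ! 11)) (segs (loops ! i))"
  unfolding all_less_5 by code_simp

lemma verts_column: "fst (verts ! 10) = fst (verts ! 11)"
  by code_simp

lemma distinct_verts: "distinct verts" "length verts = 12"
  by code_simp+

lemma verts_ends: "\<forall>i<5. verts ! (2 * i) = hd (polys ! i) \<and> verts ! (2 * i + 1) = last (polys ! i)"
  unfolding all_less_5 by code_simp

text \<open>Loop \<open>i\<close> separates the two points and is covered by the two arcs.\<close>

lemma polys_separate:
  assumes "i < 5" "connected S" "pt (verts ! 10) \<in> S" "pt (verts ! 11) \<in> S"
  shows "S \<inter> pset (polys ! i) \<noteq> {} \<or> S \<inter> pset (polys ! nbr i) \<noteq> {}"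
proof -
  have loop: "rect_loop (loops ! i)"
    using loops_rect_loop assms(1) by blast
  have ray: "snd (verts ! 11) < snd (hd (loops ! i))" "snd (hd (loops ! i)) < snd (verts ! 10)"
    "hor_between (last (loops ! i), hd (loops ! i)) (fst (verts ! 10))"
    "list_all (apart (verts ! 10, verts ! 11)) (segs (loops ! i))"
    using loops_ray assms(1) by blast+
  have "S \<inter> (pset (loops ! i) \<union> seg (last (loops ! i), hd (loops ! i))) \<noteq> {}"
    by (rule rect_loop_separates[OF loop assms(2-4) verts_column ray])
  moreover have "pset (loops ! i) \<union> seg (last (loops ! i), hd (loops ! i))
      \<subseteq> pset (polys ! i) \<union> pset (polys ! nbr i)"
    using loops_covered assms(1) by (intro covered_subset) blast
  ultimately show ?thesis
    by blast
qed

section \<open>The matchings and the prescribed drawing\<close>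

definition edge :: "nat \<Rightarrow> nat set" where
  "edge k = {2 * k, 2 * k + 1}"

text \<open>\<open>Min (edge k)\<close> is \<open>2 * k\<close>, so the division recovers the index
  of the edge.\<close>

definition fixed_drawing :: "nat drawing" where
  "fixed_drawing = \<lparr>pos = \<lambda>v. pt (verts ! v), curve = \<lambda>e. pset (polys ! (Min e div 2))\<rparr>"

lemma edge_disjoint: "i \<noteq> j \<Longrightarrow> edge i \<inter> edge j = {}"
  by (auto simp: edge_def; presburger)

lemma edge_eq_iff [simp]: "edge i = edge j \<longleftrightarrow> i = j"
  using edge_disjoint[of i j] by (auto simp: edge_def)

lemma mem_edge_iff: "v \<in> edge k \<longleftrightarrow> v div 2 = k"
  by (auto simp: edge_def)

lemma matching_edges:
  assumes "2 * n \<le> m"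
  shows "matching {..<m} (edge ` {..<n})"
  unfolding matching_def simple_graph_def
proof (intro conjI ballI impI; (elim imageE)?)
  fix e k
  assume "e = edge k" "k \<in> {..<n}"
  with assms show "e \<subseteq> {..<m}" "card e = 2"
    by (auto simp: edge_def)
qed (use edge_disjoint in auto)

lemma curve_fixed_drawing: "curve fixed_drawing (edge k) = pset (polys ! k)"
  by (simp add: fixed_drawing_def edge_def)

lemma pos_fixed_drawing: "pos fixed_drawing v = pt (verts ! v)"
  by (simp add: fixed_drawing_def)

text \<open>\<open>arcs_meet\<close> supplies a common point, and \<open>arcs_compat\<close> turns
  it into a crossing.\<close>

lemma cross_polys:
  assumes "i < 5"
  shows "cross (pset (polys ! i)) (pset (polys ! nbr i))"
proof -
  have "i \<noteq> nbr i"
    using assms by presburger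
  moreover have "nbr i < 5"
    by simp
  ultimately have "rect_arc (polys ! i)" "rect_arc (polys ! nbr i)"
    "arcs_compat (polys ! i) (polys ! nbr i)"
    using assms polys_rect_arc polys_compat by blast+
  note crossing = arcs_compat_crossing(2)[OF this]
  obtain x where "x \<in> pset (polys ! i) \<inter> pset (polys ! nbr i)"
    using arcs_meet_Int[of "polys ! i" "polys ! nbr i"] polys_meet assms by blast
  from crossing[OF this] show ?thesis
    unfolding cross_def by blast
qed

lemma cross_polys_nbr:
  assumes "i < 5" "j < 5" "i \<noteq> j" "cross (pset (polys ! i)) (pset (polys ! j))"
  shows "j = nbr i \<or> i = nbr j"
proof -
  obtain x where "x \<in> pset (polys ! i) \<inter> pset (polys ! j)"
    using assms(4) crossing_point_mem unfolding cross_def by blast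
  then have "\<not> arcs_apart (polys ! i) (polys ! j)"
    using arcs_apart_disjoint by blast
  then show ?thesis
    using assms(1-3) polys_apart by blast
qed

lemma drawing_of_fixed_drawing: "drawing_of {..<12} (edge ` {..<5}) fixed_drawing"
  unfolding drawing_of_def
proof (intro conjI ballI impI; (elim imageE)?)
  show "inj_on (pos fixed_drawing) {..<12}"
    using distinct_verts by (auto simp: inj_on_def pos_fixed_drawing nth_eq_iff_index_eq)
next
  fix e k
  assume e: "e = edge k" "k \<in> {..<5}"
  then have "rect_arc (polys ! k)"
    using polys_rect_arc by auto
  then show "\<exists>g. arc g \<and> path_image g = curve fixed_drawing e \<and>
      {pathstart g, pathfinish g} = pos fixed_drawing ` e"
    using rect_arc_arc[of "polys ! k"] verts_ends e
    by (intro exI[of _ "ppath (polys ! k)"])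
      (simp add: curve_fixed_drawing, simp add: pos_fixed_drawing edge_def)
next
  fix e k v
  assume e: "e = edge k" "k \<in> {..<5}" and v: "v \<in> {..<12::nat}" "v \<notin> e"
  have "v \<in> set [0..<12]" "v div 2 \<noteq> k"
    using e v by (auto simp: mem_edge_iff)
  moreover have "\<forall>v\<in>set [0..<12]. v div 2 = k \<or>
      list_all (apart (verts ! v, verts ! v)) (segs (polys ! k))"
    using verts_apart[rule_format, of k] e unfolding list_all_iff[of _ "[0..<12]"] by blast
  ultimately have "list_all (apart (verts ! v, verts ! v)) (segs (polys ! k))"
    by blast
  then show "pos fixed_drawing v \<notin> curve fixed_drawing e"
    using apart_pset_disjoint[of "(verts ! v, verts ! v)" "polys ! k"]
    by (auto simp: e curve_fixed_drawing pos_fixed_drawing seg_def)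
next
  fix e f i j
  assume "e = edge i" "i \<in> {..<5}" "f = edge j" "j \<in> {..<5}" "e \<noteq> f"
  then show "finite (curve fixed_drawing e \<inter> curve fixed_drawing f)"
    using arcs_compat_crossing(1)[of "polys ! i" "polys ! j"] polys_rect_arc polys_compat
    by (auto simp: curve_fixed_drawing)
next
  fix e f x i j
  assume "x \<in> curve fixed_drawing e \<inter> curve fixed_drawing f"
    "e = edge i" "i \<in> {..<5}" "f = edge j" "j \<in> {..<5}" "e \<noteq> f"
  then show "x \<in> pos fixed_drawing ` (e \<inter> f) \<or>
      crossing_point (curve fixed_drawing e) (curve fixed_drawing f) x"
    using arcs_compat_crossing(2)[of "polys ! i" "polys ! j" x] polys_rect_arc polys_compat
    by (auto simp: curve_fixed_drawing)
qed

text \<open>Three pairwise crossing arcs would form a triangle in the cycle of neighbours.\<close>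

lemma quasiplanar_fixed_drawing: "quasiplanar_drawing {..<12} (edge ` {..<5}) fixed_drawing"
proof -
  have False
    if "i < 5" "j < 5" "k < 5" "i \<noteq> j" "i \<noteq> k" "j \<noteq> k"
      "cross (pset (polys ! i)) (pset (polys ! j))" "cross (pset (polys ! i)) (pset (polys ! k))"
      "cross (pset (polys ! j)) (pset (polys ! k))" for i j k
  proof -
    have "j = nbr i \<or> i = nbr j" "k = nbr i \<or> i = nbr k" "k = nbr j \<or> j = nbr k"
      using that cross_polys_nbr by blast+
    then show False
      using nbr_triangle_free that(1-6) by blast
  qed
  then show ?thesis
    unfolding quasiplanar_drawing_def
    by (auto simp: drawing_of_fixed_drawing curve_fixed_drawing)
qed

section \<open>Impossibility of adding the sixth edge\<close>

lemma fixed_drawing_not_extendable: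
  assumes \<Gamma>: "quasiplanar_drawing {..<12} (edge ` {..<6}) \<Gamma>"
    and pos: "\<And>v. v < 12 \<Longrightarrow> pos \<Gamma> v = pos fixed_drawing v"
    and cur: "\<And>k. k < 5 \<Longrightarrow> curve \<Gamma> (edge k) = curve fixed_drawing (edge k)"
  shows False
proof -
  define G where "G = curve \<Gamma> (edge 5)"
  define X where "X k \<longleftrightarrow> G \<inter> pset (polys ! k) \<noteq> {}" for k
  have D: "drawing_of {..<12} (edge ` {..<6}) \<Gamma>"
    using \<Gamma> unfolding quasiplanar_drawing_def by (rule conjunct1)
  have "edge 5 \<in> edge ` {..<6}"
    by (rule imageI) simp
  moreover have "\<forall>e\<in>edge ` {..<6}. \<exists>g. arc g \<and> path_image g = curve \<Gamma> e \<and>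
      {pathstart g, pathfinish g} = pos \<Gamma> ` e"
    using D unfolding drawing_of_def by (elim conjE)
  ultimately obtain g where g: "arc g" "path_image g = G"
    "{pathstart g, pathfinish g} = pos \<Gamma> ` edge 5"
    unfolding G_def by (elim ballE exE conjE) blast+
  have "pos \<Gamma> ` edge 5 = {pt (verts ! 10), pt (verts ! 11)}"
    using pos[of 10] pos[of 11] by (simp add: edge_def pos_fixed_drawing)
  moreover have "{pathstart g, pathfinish g} \<subseteq> G"
    using g(2) pathstart_in_path_image[of g] pathfinish_in_path_image[of g] by simp
  ultimately have "pt (verts ! 10) \<in> G" "pt (verts ! 11) \<in> G"
    unfolding g(3) by simp_all
  moreover have "connected G"
    using g(1,2) connected_arc_image by blast
  ultimately have X: "X i \<or> X (nbr i)" if "i < 5" for i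
    using polys_separate[OF that] by (simp add: X_def)
  have cross_G: "cross G (pset (polys ! k))" if k: "k < 5" "X k" for k
  proof -
    obtain x where x: "x \<in> curve \<Gamma> (edge 5) \<inter> curve \<Gamma> (edge k)"
      using k(2) unfolding X_def G_def cur[OF k(1)] curve_fixed_drawing by blast
    have "edge 5 \<in> edge ` {..<6}" "edge k \<in> edge ` {..<6}" "edge 5 \<noteq> edge k"
      using k(1) by auto
    moreover have "\<forall>e\<in>edge ` {..<6}. \<forall>f\<in>edge ` {..<6}. e \<noteq> f \<longrightarrow>
        finite (curve \<Gamma> e \<inter> curve \<Gamma> f) \<and>
        (\<forall>x \<in> curve \<Gamma> e \<inter> curve \<Gamma> f. x \<in> pos \<Gamma> ` (e \<inter> f) \<or>
          crossing_point (curve \<Gamma> e) (curve \<Gamma> f) x)"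
      using D unfolding drawing_of_def by (elim conjE)
    ultimately have "x \<in> pos \<Gamma> ` (edge 5 \<inter> edge k) \<or>
        crossing_point (curve \<Gamma> (edge 5)) (curve \<Gamma> (edge k)) x"
      using x by (meson bspec)
    \<comment> \<open>Without a shared vertex, a common point of the two curves has to be a
      crossing.\<close>
    moreover have "edge 5 \<inter> edge k = {}"
      using k(1) by (intro edge_disjoint) simp
    ultimately show ?thesis
      unfolding cross_def G_def cur[OF k(1)] curve_fixed_drawing by blast
  qed
  \<comment> \<open>Otherwise exactly one of any two neighbours would satisfy \<open>X\<close>, so
    \<open>X\<close> would alternate around a cycle of odd length.\<close>
  have "\<exists>i<5. X i \<and> X (nbr i)"
  proof (rule ccontr)
    assume "\<not> (\<exists>i<5. X i \<and> X (nbr i))"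
    with X have "\<forall>i<5. X (nbr i) \<longleftrightarrow> \<not> X i"
      by blast
    then show False
      unfolding all_less_5 by (simp add: numeral_2_eq_2, blast)
  qed
  then obtain i where i: "i < 5" "X i" "X (nbr i)"
    by blast
  have nbr: "nbr i < 5" "i \<noteq> nbr i"
    using i(1) by (simp, presburger)
  have "cross (curve \<Gamma> (edge 5)) (curve \<Gamma> (edge i))"
    "cross (curve \<Gamma> (edge 5)) (curve \<Gamma> (edge (nbr i)))"
    "cross (curve \<Gamma> (edge i)) (curve \<Gamma> (edge (nbr i)))"
    unfolding cur[OF i(1)] cur[OF nbr(1)] curve_fixed_drawing
    using cross_G[OF i(1,2)] cross_G[OF nbr(1) i(3)] cross_polys[OF i(1)]
    by (simp_all only: G_def)
  moreover have "edge 5 \<in> edge ` {..<6}" "edge i \<in> edge ` {..<6}" "edge (nbr i) \<in> edge ` {..<6}"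
    using i(1) nbr(1) by (auto intro!: imageI)
  moreover have "edge 5 \<noteq> edge i" "edge 5 \<noteq> edge (nbr i)" "edge i \<noteq> edge (nbr i)"
    using i(1) nbr unfolding edge_eq_iff by linarith+
  ultimately show False
    using \<Gamma>[unfolded quasiplanar_drawing_def, THEN conjunct2] by metis
qed

text \<open>The first matching is contained in the second, so all its curves are shared and the
  second drawing has to extend the prescribed one by a single edge.\<close>

theorem theorem7:
  "\<exists>(V :: nat set) E1 E2 \<Gamma>1.
     matching V E1 \<and> matching V E2 \<and> quasiplanar_drawing V E1 \<Gamma>1 \<and>
     \<not> (\<exists>\<Gamma>s. quasefe V [E1, E2] \<Gamma>s \<and> same_drawing V E1 (\<Gamma>s ! 0) \<Gamma>1)"
proof (intro exI conjI notI)
  show "matching {..<12} (edge ` {..<5})" "matching {..<12} (edge ` {..<6})"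
    by (simp_all add: matching_edges)
  show "quasiplanar_drawing {..<12} (edge ` {..<5}) fixed_drawing"
    by (rule quasiplanar_fixed_drawing)
  assume "\<exists>\<Gamma>s. quasefe {..<12} [edge ` {..<5}, edge ` {..<6}] \<Gamma>s \<and>
    same_drawing {..<12} (edge ` {..<5}) (\<Gamma>s ! 0) fixed_drawing"
  then obtain \<Gamma>s where Q: "quasefe {..<12} [edge ` {..<5}, edge ` {..<6}] \<Gamma>s"
    and S: "same_drawing {..<12} (edge ` {..<5}) (\<Gamma>s ! 0) fixed_drawing"
    by blast
  have planar: "quasiplanar_drawing {..<12} ([edge ` {..<5}, edge ` {..<6}] ! i) (\<Gamma>s ! i)"
    if "i < length [edge ` {..<5}, edge ` {..<6}]" for i
    using Q that unfolding quasefe_def by blast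
  have shared: "(\<forall>v\<in>{..<12}. pos (\<Gamma>s ! i) v = pos (\<Gamma>s ! j) v) \<and>
      (\<forall>e \<in> [edge ` {..<5}, edge ` {..<6}] ! i \<inter> [edge ` {..<5}, edge ` {..<6}] ! j.
        curve (\<Gamma>s ! i) e = curve (\<Gamma>s ! j) e)"
    if "i < length [edge ` {..<5}, edge ` {..<6}]" "j < length [edge ` {..<5}, edge ` {..<6}]" for i j
    using Q that unfolding quasefe_def by blast
  show False
  proof (rule fixed_drawing_not_extendable[of "\<Gamma>s ! 1"])
    show "quasiplanar_drawing {..<12} (edge ` {..<6}) (\<Gamma>s ! 1)"
      using planar[of 1] by simp
    show "pos (\<Gamma>s ! 1) v = pos fixed_drawing v" if "v < 12" for v
      using shared[of 1 0] S that by (simp add: same_drawing_def)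
    show "curve (\<Gamma>s ! 1) (edge k) = curve fixed_drawing (edge k)" if "k < 5" for k
    proof -
      have "edge k \<in> edge ` {..<5}" "edge k \<in> edge ` {..<6}"
        using that by auto
      then show ?thesis
        using shared[of 1 0] S unfolding same_drawing_def by auto
    qed
  qed
qed

end
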